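(* For every positive integer $n\neq 4$ we have $$2^{1-n}\cdot n\cdot\binom{n-1}{\lfloor (n-1)/2\rfloor}>\left(\frac{2}{\pi}\int_0^\infty\left(\frac{\sin x}{x}\right)^n\,dx\right)^{-1}.$$
   Context: For $n=1$ the integral is a convergent improper Riemann integral, $\lim_{T\to\infty}\int_0^T$.
   Formalization: The cases n = 1 and n = 2 are excluded in addition to n = 4, because there both sides equal 1 (the integral is π/2 in both cases) and the strict inequality fails. *)

theory Defs
  imports "HOL-Probability.Sinc_Integral"
begin

(* The integral over [0, infinity) as an improper Riemann integral, which also makes sense
   for n = 1, where the integrand is not absolutely integrable.  The junk value of the
   integrand at x = 0 does not affect the integral. *)
definition sinc_power_integral :: "nat \<Rightarrow> real" where
  "sinc_power_integral n = Lim at_top (\<lambda>T::real. integral {0..T} (\<lambda>x. (sin x / x) ^ n))"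

(* The strict inequality
     2 powi (1 - int n) * real n * real ((n - 1) choose ((n - 1) div 2))
       > inverse (2 / pi * sinc_power_integral n)
   fails for n = 1 and n = 2, where both sides are equal (to 1). The lemmas
   binomial_eq_1 and binomial_eq_2 below prove this. *)

lemma tendsto_sinc_power_integral_1:
  "((\<lambda>T::real. integral {0..T} (\<lambda>x. (sin x / x) ^ 1)) \<longlongrightarrow> pi / 2) at_top"
proof (rule Lim_transform_eventually[OF Si_at_top])
  show "\<forall>\<^sub>F T in at_top. Si T = integral {0..T} (\<lambda>x. (sin x / x) ^ 1)"
    using eventually_ge_at_top[of 0]
  proof eventually_elim
    case (elim T)
    have "((\<lambda>x. (sin x / x) ^ 1) has_integral (Si T - Si 0)) {0..T}"
    proof (rule fundamental_theorem_of_calculus_strong[of "{0}"])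
      fix x assume "x \<in> {0..T} - {0}"
      then show "(Si has_vector_derivative (sin x / x) ^ 1) (at x)"
        using DERIV_Si[of x] by (simp add: has_real_derivative_iff_has_vector_derivative)
    qed (use elim isCont_Si in \<open>auto intro: continuous_at_imp_continuous_on\<close>)
    moreover have "Si 0 = 0" using Si_neg[of 0] by simp
    ultimately show ?case by (simp add: integral_unique)
  qed
qed

lemma tendsto_sinc_power_integral_2:
  "((\<lambda>T::real. integral {0..T} (\<lambda>x. (sin x / x) ^ 2)) \<longlongrightarrow> pi / 2) at_top"
proof -
  define F where "F = (\<lambda>x::real. Si (2 * x) - sin x * sinc x)"
  have "((\<lambda>x::real. Si (2 * x)) \<longlongrightarrow> pi / 2) at_top"
    by (rule filterlim_compose[OF Si_at_top])
       (rule filterlim_tendsto_pos_mult_at_top[OF tendsto_const], auto simp: filterlim_ident)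
  moreover have "((\<lambda>x::real. sin x * sinc x) \<longlongrightarrow> 0) at_top"
  proof (rule Lim_null_comparison)
    show "\<forall>\<^sub>F x::real in at_top. norm (sin x * sinc x) \<le> inverse x"
      using eventually_gt_at_top[of 0]
    proof eventually_elim
      case (elim x)
      have "\<bar>sin x\<bar> * \<bar>sin x\<bar> \<le> 1 * 1" by (rule mult_mono) auto
      with elim show ?case by (simp add: abs_mult field_simps)
    qed
    show "((\<lambda>x::real. inverse x) \<longlongrightarrow> 0) at_top" by (rule tendsto_inverse_0_at_top[OF filterlim_ident])
  qed
  ultimately have F_lim: "(F \<longlongrightarrow> pi / 2) at_top"
    unfolding F_def using tendsto_diff by fastforce
  show ?thesis
  proof (rule Lim_transform_eventually[OF F_lim])
    show "\<forall>\<^sub>F T in at_top. F T = integral {0..T} (\<lambda>x. (sin x / x) ^ 2)"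
      using eventually_ge_at_top[of 0]
    proof eventually_elim
      case (elim T)
      have "((\<lambda>x. (sin x / x) ^ 2) has_integral (F T - F 0)) {0..T}"
      proof (rule fundamental_theorem_of_calculus_strong[of "{0}"])
        fix x assume "x \<in> {0..T} - {0}"
        then have x: "x > 0" by auto
        have d1: "((\<lambda>x. Si (2 * x)) has_real_derivative sinc (2 * x) * 2) (at x)"
          by (rule DERIV_chain2[OF DERIV_Si]) (auto intro!: derivative_eq_intros)
        have d2: "((\<lambda>x. sin x / x) has_real_derivative (cos x * x - sin x) / (x * x)) (at x)"
          using x by (auto intro!: derivative_eq_intros)
        have d3: "((\<lambda>x. Si (2 * x) - sin x * (sin x / x)) has_real_derivative
                sinc (2 * x) * 2 - (cos x * (sin x / x) + (cos x * x - sin x) / (x * x) * sin x)) (at x)"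
          by (rule DERIV_diff[OF d1 DERIV_mult[OF DERIV_sin d2]])
        have "sinc (2 * x) * 2 - (cos x * (sin x / x) + (cos x * x - sin x) / (x * x) * sin x)
            = (sin x / x) ^ 2"
        proof -
          have "2 * s * c / (2 * x) * 2 - (c * (s / x) + (c * x - s) / (x * x) * s) = (s / x) ^ 2"
            for s c :: real
          proof -
            have "(c * x - s) / (x * x) = c / x - s / (x * x)"
              using x by (simp add: diff_divide_distrib)
            then show ?thesis by (simp add: power2_eq_square left_diff_distrib)
          qed
          moreover have "sinc (2 * x) = 2 * sin x * cos x / (2 * x)"
            using x by (simp add: sin_double)
          ultimately show ?thesis by (simp only:)
        qed
        with d3 have d4: "((\<lambda>x. Si (2 * x) - sin x * (sin x / x)) has_real_derivative (sin x / x) ^ 2) (at x)"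
          by (simp only:)
        have "(F has_real_derivative (sin x / x) ^ 2) (at x)"
          by (rule has_field_derivative_transform_within_open[OF d4, of "{0<..}"])
             (use x in \<open>auto simp: F_def\<close>)
        then show "(F has_vector_derivative (sin x / x) ^ 2) (at x)"
          by (simp add: has_real_derivative_iff_has_vector_derivative)
      next
        have Si_cont: "continuous_on UNIV Si"
          by (auto intro: continuous_at_imp_continuous_on isCont_Si)
        show "continuous_on {0..T} F"
          unfolding F_def
          by (intro continuous_on_diff continuous_on_mult continuous_on_sinc continuous_on_sin
                continuous_on_compose2[OF Si_cont, of _ "\<lambda>x. 2 * x"] continuous_on_mult_const
                continuous_on_id) auto
      qed (use elim in auto)
      moreover have "F 0 = 0" using Si_neg[of 0] by (simp add: F_def)
      ultimately show ?case by (simp add: integral_unique)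
    qed
  qed
qed

lemma binomial_eq_1:
  fixes n :: nat
  assumes "n = 1"
  shows "2 powi (1 - int n) * real n * real ((n - 1) choose ((n - 1) div 2))
       = inverse (2 / pi * sinc_power_integral n)"
proof -
  have "sinc_power_integral 1 = pi / 2"
    unfolding sinc_power_integral_def
    by (rule tendsto_Lim[OF _ tendsto_sinc_power_integral_1]) simp
  then have "2 / pi * sinc_power_integral n = 1"
    unfolding assms by (simp only:) simp
  then show ?thesis
    unfolding \<open>2 / pi * sinc_power_integral n = 1\<close> by (simp add: assms power_int_minus)
qed

lemma binomial_eq_2:
  fixes n :: nat
  assumes "n = 2"
  shows "2 powi (1 - int n) * real n * real ((n - 1) choose ((n - 1) div 2))
       = inverse (2 / pi * sinc_power_integral n)"
proof -
  have "sinc_power_integral 2 = pi / 2"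
    unfolding sinc_power_integral_def
    by (rule tendsto_Lim[OF _ tendsto_sinc_power_integral_2]) simp
  then have "2 / pi * sinc_power_integral n = 1"
    unfolding assms by (simp only:) simp
  then show ?thesis
    unfolding \<open>2 / pi * sinc_power_integral n = 1\<close> by (simp add: assms power_int_minus)
qed

end

theory Submission
  imports Defs
begin

text \<open>
  Write \<open>I\<close> for the integral over \<open>[0, \<infinity>)\<close> and \<open>w\<close> for the left-hand side of the inequality. The
  claim is \<open>w I > \<pi> / 2\<close>. Both factors follow a power law: \<open>I\<close> is about \<open>sqrt (3 \<pi> / (2 n))\<close>, because
  \<open>sin x / x\<close> is close to \<open>exp (- x\<^sup>2 / 6)\<close>, and \<open>w\<close> is about \<open>sqrt (2 n / \<pi>)\<close>. So \<open>w I\<close> tends to \<open>sqrt 3\<close>,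
  which leaves a margin of ten per cent over \<open>\<pi> / 2\<close> for large \<open>n\<close>; the work is to have an estimate of \<open>I\<close>
  that is sharp enough for small \<open>n\<close> and is easy to follow as \<open>n\<close> grows.

  The estimate replaces \<open>sin x / x\<close> by the parabola \<open>a = 1 - x\<^sup>2 / 6\<close> on \<open>[0, sqrt 6]\<close>. The integral \<open>K n\<close> of
  \<open>a ^ n\<close> is a Wallis integral: it obeys a first-order recurrence, as \<open>w\<close> does with step two. Hence along each
  parity class \<open>w K\<close> changes by an explicit rational factor, and this factor is greater than one. The
  inequality then follows by induction from a single numerical check in each class.

  For odd \<open>n\<close> the class starts at \<open>3\<close>. The integrand may be negative beyond \<open>\<pi>\<close>, and beyond \<open>3\<close> it is bounded by
  \<open>x ^ - n\<close>; the resulting error, multiplied by \<open>w\<close>, decreases with \<open>n\<close>. For even \<open>n\<close> nothing is lost beyond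
  \<open>sqrt 6\<close>, but the class starts at \<open>6\<close> (at \<open>4\<close> there is equality), where \<open>w K\<close> falls just below \<open>\<pi> / 2\<close>.
  The next Taylor term of the sine repairs this: it improves \<open>K n\<close> by the factor
  \<open>1 + 27 / (70 (2 n + 3))\<close> (lemma \<open>integral_sinc_power_ge\<close>), and the improved product still increases.
\<close>

section \<open>Convergence of the improper integral\<close>

lemma mono_bounded_tendsto_at_top:
  fixes f :: "real \<Rightarrow> real"
  assumes mono: "\<And>x y. a \<le> x \<Longrightarrow> x \<le> y \<Longrightarrow> f x \<le> f y"
    and bounded: "\<And>x. a \<le> x \<Longrightarrow> f x \<le> B"
  obtains L where "(f \<longlongrightarrow> L) at_top" "\<And>x. a \<le> x \<Longrightarrow> f x \<le> L"
proof
  define L where "L = Sup (f ` {a..})"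
  have bdd: "bdd_above (f ` {a..})"
    using bounded by (intro bdd_aboveI2[of _ _ B]) auto
  show upper: "f x \<le> L" if "a \<le> x" for x
    unfolding L_def using that by (intro cSup_upper bdd) auto
  show "(f \<longlongrightarrow> L) at_top"
  proof (rule order_tendstoI)
    fix c assume "c < L"
    then obtain x where x: "a \<le> x" "c < f x"
      unfolding L_def using less_cSup_iff[OF _ bdd, of c] by auto
    show "\<forall>\<^sub>F y in at_top. c < f y"
      using eventually_ge_at_top[of x]
      by eventually_elim (use x mono[of x] in force)
  next
    fix c assume "L < c"
    show "\<forall>\<^sub>F y in at_top. f y < c"
      using eventually_ge_at_top[of a]
      by eventually_elim (use upper \<open>L < c\<close> in force)
  qed
qed

lemma integrable_sinc_power:
  "(\<lambda>x::real. (sin x / x) ^ n) integrable_on {a..b}"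
proof (rule integrable_spike[of _ _ "{0}"])
  show "(\<lambda>x. sinc x ^ n) integrable_on {a..b}"
    by (intro integrable_continuous_real continuous_intros)
qed auto

lemma abs_sinc_power_le:
  assumes "x > (0::real)"
  shows "\<bar>(sin x / x) ^ n\<bar> \<le> 1 / x ^ n"
proof -
  have "\<bar>sin x\<bar> ^ n \<le> 1 ^ n"
    by (intro power_mono) auto
  with assms show ?thesis
    by (simp add: power_abs power_divide divide_right_mono)
qed

lemma has_integral_inverse_power:
  assumes "k > 0" "0 < S" "S \<le> T"
  shows "((\<lambda>x::real. 1 / x ^ Suc k) has_integral (1 / (real k * S ^ k) - 1 / (real k * T ^ k))) {S..T}"
proof -
  let ?P = "\<lambda>x::real. - ((1 / x) ^ k / real k)"
  have "((\<lambda>x::real. 1 / x ^ Suc k) has_integral (?P T - ?P S)) {S..T}"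
  proof (rule fundamental_theorem_of_calculus)
    fix x assume "x \<in> {S..T}"
    then have x: "x > 0" using assms by auto
    obtain j where j: "k = Suc j" using assms by (cases k) auto
    have "((\<lambda>x. 1 / x) has_real_derivative - (1 / x\<^sup>2)) (at x)"
      using x by (auto intro!: derivative_eq_intros simp: power2_eq_square)
    from DERIV_minus[OF DERIV_cdivide[OF DERIV_power_Suc[OF this, of j], of "real k"]]
    have "(?P has_real_derivative 1 / x ^ Suc k) (at x)"
      using x add_pos_nonneg[of 1 "real j"]
      by (simp add: j power_one_over power2_eq_square divide_simps mult.assoc)
    then show "(?P has_vector_derivative 1 / x ^ Suc k) (at x within {S..T})"
      by (simp add: has_real_derivative_iff_has_vector_derivative has_vector_derivative_at_within)
  qed (use assms in auto)
  then show ?thesis by (simp add: power_one_over mult.commute)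
qed

text \<open>Since the right-hand side telescopes, the integral up to \<open>T\<close> becomes increasing when
  \<open>1 / (k T ^ k)\<close> is subtracted and decreasing when it is added. This gives convergence and the error
  of truncation at once.\<close>

lemma abs_integral_sinc_power_diff_le:
  assumes "k > 0" "0 < S" "S \<le> T"
  shows "\<bar>integral {0..T} (\<lambda>x. (sin x / x) ^ Suc k) - integral {0..S} (\<lambda>x. (sin x / x) ^ Suc k)\<bar>
           \<le> 1 / (real k * S ^ k) - 1 / (real k * T ^ k)"
proof -
  let ?f = "\<lambda>x::real. (sin x / x) ^ Suc k"
  have "integral {0..S} ?f + integral {S..T} ?f = integral {0..T} ?f"
    using assms by (intro Henstock_Kurzweil_Integration.integral_combine integrable_sinc_power) auto
  moreover have "norm (integral {S..T} ?f) \<le> integral {S..T} (\<lambda>x. 1 / x ^ Suc k)"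
  proof (rule integral_norm_bound_integral[OF integrable_sinc_power])
    show "(\<lambda>x::real. 1 / x ^ Suc k) integrable_on {S..T}"
      using has_integral_inverse_power[OF assms] by blast
    show "norm (?f x) \<le> 1 / x ^ Suc k" if "x \<in> {S..T}" for x
      using abs_sinc_power_le[of x "Suc k"] that assms by (simp only: real_norm_def) auto
  qed
  moreover have "integral {S..T} (\<lambda>x. 1 / x ^ Suc k) = 1 / (real k * S ^ k) - 1 / (real k * T ^ k)"
    using has_integral_inverse_power[OF assms] by blast
  ultimately show ?thesis by (simp del: power_Suc)
qed

lemma sinc_power_integral_tendsto:
  assumes "k > 0"
  shows "((\<lambda>T. integral {0..T} (\<lambda>x. (sin x / x) ^ Suc k)) \<longlongrightarrow> sinc_power_integral (Suc k)) at_top"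
    and "S \<ge> 1 \<Longrightarrow> integral {0..S} (\<lambda>x. (sin x / x) ^ Suc k) - 1 / (real k * S ^ k)
           \<le> sinc_power_integral (Suc k)"
proof -
  define F where "F = (\<lambda>T::real. integral {0..T} (\<lambda>x. (sin x / x) ^ Suc k))"
  define H where "H = (\<lambda>T. F T - 1 / (real k * T ^ k))"
  have diff: "\<bar>F y - F x\<bar> \<le> 1 / (real k * x ^ k) - 1 / (real k * y ^ k)" if "0 < x" "x \<le> y" for x y
    using abs_integral_sinc_power_diff_le[OF assms that] unfolding F_def .
  have mono: "H x \<le> H y" if "1 \<le> x" "x \<le> y" for x y
  proof -
    have "\<bar>F y - F x\<bar> \<le> 1 / (real k * x ^ k) - 1 / (real k * y ^ k)"
      using that by (intro diff) auto
    then show ?thesis unfolding H_def by linarith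
  qed
  have bounded: "H x \<le> F 1 + 1 / real k" if "1 \<le> x" for x
  proof -
    have "0 \<le> 1 / (real k * x ^ k)" using that by simp
    moreover have "\<bar>F x - F 1\<bar> \<le> 1 / (real k * 1 ^ k) - 1 / (real k * x ^ k)"
      using that by (intro diff) auto
    ultimately show ?thesis unfolding H_def power_one mult_1_right by linarith
  qed
  \<comment> \<open>The correction between \<open>H\<close> and \<open>F\<close> vanishes at infinity, so both have the same limit.\<close>
  obtain L where L: "(H \<longlongrightarrow> L) at_top" "\<And>x. 1 \<le> x \<Longrightarrow> H x \<le> L"
    using mono_bounded_tendsto_at_top[of 1 H, OF mono bounded] by blast
  have "((\<lambda>T::real. 1 / (real k * T ^ k)) \<longlongrightarrow> 0) at_top"
    using assms
    by (intro real_tendsto_divide_at_top[OF tendsto_const]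
          filterlim_tendsto_pos_mult_at_top[OF tendsto_const] filterlim_pow_at_top filterlim_ident) auto
  from tendsto_add[OF L(1) this] have lim: "(F \<longlongrightarrow> L) at_top"
    unfolding H_def by simp
  then have "sinc_power_integral (Suc k) = L"
    unfolding sinc_power_integral_def F_def by (intro tendsto_Lim) auto
  with lim L(2) show "((\<lambda>T. integral {0..T} (\<lambda>x. (sin x / x) ^ Suc k)) \<longlongrightarrow> sinc_power_integral (Suc k)) at_top"
    and "S \<ge> 1 \<Longrightarrow> integral {0..S} (\<lambda>x. (sin x / x) ^ Suc k) - 1 / (real k * S ^ k)
           \<le> sinc_power_integral (Suc k)"
    unfolding F_def H_def by auto
qed

lemma sinc_power_integral_even_ge:
  assumes "even n" "n > 0"
  shows "integral {0..S} (\<lambda>x. (sin x / x) ^ n) \<le> sinc_power_integral n"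
proof -
  obtain k where k: "n = Suc k" "k > 0"
    using assms by (cases n) (auto intro: Nat.gr0I)
  show ?thesis
  proof (rule tendsto_lowerbound)
    show "((\<lambda>T. integral {0..T} (\<lambda>x. (sin x / x) ^ n)) \<longlongrightarrow> sinc_power_integral n) at_top"
      unfolding k(1) by (rule sinc_power_integral_tendsto(1)[OF k(2)])
    show "\<forall>\<^sub>F T in at_top. integral {0..S} (\<lambda>x. (sin x / x) ^ n) \<le> integral {0..T} (\<lambda>x. (sin x / x) ^ n)"
      using eventually_ge_at_top[of S]
    proof eventually_elim
      case (elim T)
      show ?case
        using elim assms(1)
        by (intro integral_subset_le integrable_sinc_power) (auto intro: zero_le_even_power)
    qed
  qed simp
qed

section \<open>Bounds for the sine\<close>

lemma abs_sin_minus_Taylor_9_le: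
  fixes x :: real
  assumes "x > 0"
  shows "\<bar>sin x - (x - x ^ 3 / 6 + x ^ 5 / 120 - x ^ 7 / 5040 + x ^ 9 / 362880)\<bar> \<le> x ^ 11 / 39916800"
  using Maclaurin_sin_bound[of x 11] assms
  by (simp add: sin_coeff_def lessThan_nat_numeral fact_numeral algebra_simps)

text \<open>The sign of the sine locates \<open>\<pi>\<close>. The upper bound is chosen because the estimate at \<open>n = 3\<close> barely
  yields \<open>w I > 1.595\<close>; the lower bound makes the sine nonnegative on \<open>[0, 3]\<close>.\<close>

lemma pi_bounds: "3 < pi" "pi < 319 / 100"
proof -
  have "sin (3::real) > 0"
    using abs_sin_minus_Taylor_9_le[of 3] unfolding abs_le_iff by simp
  then show "3 < pi"
    using sin_lt_zero[of 3] pi_ge_two sin_pi by (cases "pi = 3") force+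
  have "sin (319 / 100 :: real) < 0"
    using abs_sin_minus_Taylor_9_le[of "319 / 100"] unfolding abs_le_iff by (simp add: power_divide)
  then show "pi < 319 / 100"
    using sin_ge_zero[of "319 / 100"] by force
qed

lemma sin_ge_Taylor_7:
  fixes x :: real
  assumes "x > 0"
  shows "x - x ^ 3 / 6 + x ^ 5 / 120 - x ^ 7 / 5040 \<le> sin x"
proof -
  have "\<bar>sin x - (x - x ^ 3 / 6 + x ^ 5 / 120)\<bar> \<le> x ^ 7 / 5040"
    using Maclaurin_sin_bound[of x 7] assms
    by (simp add: sin_coeff_def lessThan_nat_numeral fact_numeral algebra_simps)
  then show ?thesis by linarith
qed

text \<open>On \<open>[0, sqrt 6]\<close> the term \<open>x ^ 6 / 5040\<close> is at most \<open>x ^ 4 / 840\<close>, and \<open>1 / 120 - 1 / 840 = 1 / 140\<close>.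
  With \<open>a = 1 - x\<^sup>2 / 6\<close> the quartic term is \<open>9 / 35 (1 - a)\<^sup>2\<close>, so the bound is a polynomial in \<open>a\<close>.\<close>

lemma sinc_ge_quartic:
  fixes x :: real
  assumes "0 < x" "x\<^sup>2 \<le> 6"
  shows "(1 - x\<^sup>2 / 6) + x ^ 4 / 140 \<le> sin x / x"
proof -
  have "x\<^sup>2 * x ^ 4 \<le> 6 * x ^ 4"
    using assms by (intro mult_right_mono) auto
  then have "x * ((1 - x\<^sup>2 / 6) + x ^ 4 / 140) \<le> x * (1 - x\<^sup>2 / 6 + x ^ 4 / 120 - x ^ 6 / 5040)"
    using assms by (intro mult_left_mono) (auto simp: power_add[symmetric])
  also have "\<dots> = x - x ^ 3 / 6 + x ^ 5 / 120 - x ^ 7 / 5040"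
    by (simp add: eval_nat_numeral field_simps)
  also have "\<dots> \<le> sin x" by (rule sin_ge_Taylor_7) fact
  finally show ?thesis using assms by (simp add: field_simps)
qed

text \<open>The first two terms of the binomial expansion; the others are nonnegative.\<close>

lemma add_power_ge:
  fixes a b :: real
  assumes "a \<ge> 0" "b \<ge> 0"
  shows "a ^ Suc n + real (Suc n) * a ^ n * b \<le> (a + b) ^ Suc n"
proof (induction n)
  case (Suc n)
  have "a ^ Suc (Suc n) + real (Suc (Suc n)) * a ^ Suc n * b
      \<le> (a + b) * (a ^ Suc n + real (Suc n) * a ^ n * b)"
    using assms by (simp add: algebra_simps)
  also have "\<dots> \<le> (a + b) * (a + b) ^ Suc n"
    using Suc assms by (intro mult_left_mono) auto
  finally show ?case by simp
qed (use assms in simp)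

section \<open>The polynomial comparison integral\<close>

text \<open>Substituting \<open>x = sqrt 6 sin t\<close> turns this into \<open>sqrt 6\<close> times the Wallis integral of
  \<open>cos t ^ (2 n + 1)\<close> over \<open>[0, \<pi> / 2]\<close>.\<close>

definition parabola_integral :: "nat \<Rightarrow> real" where
  "parabola_integral n = integral {0..sqrt 6} (\<lambda>x. (1 - x\<^sup>2 / 6) ^ n)"

lemma has_integral_parabola:
  "((\<lambda>x. (1 - x\<^sup>2 / 6) ^ n) has_integral parabola_integral n) {0..sqrt 6}"
  unfolding parabola_integral_def
  by (intro integrable_integral integrable_continuous_real continuous_intros) auto

lemma parabola_integral_0: "parabola_integral 0 = sqrt 6"
  unfolding parabola_integral_def by simp

text \<open>The function \<open>x (1 - x\<^sup>2 / 6) ^ (n + 1)\<close> vanishes at both end points, and its derivative is a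
  combination of the two integrands.\<close>

lemma parabola_integral_recurrence:
  "real (2 * n + 3) * parabola_integral (Suc n) = real (2 * n + 2) * parabola_integral n"
proof -
  let ?a = "\<lambda>x::real. 1 - x\<^sup>2 / 6"
  have "((\<lambda>x. real (2 * n + 3) * ?a x ^ Suc n - real (2 * n + 2) * ?a x ^ n) has_integral
          (sqrt 6 * ?a (sqrt 6) ^ Suc n - 0 * ?a 0 ^ Suc n)) {0..sqrt 6}"
  proof (rule fundamental_theorem_of_calculus)
    fix x :: real
    have "(?a has_real_derivative - (x / 3)) (at x)"
      by (auto intro!: derivative_eq_intros)
    from DERIV_mult[OF DERIV_ident DERIV_power_Suc[OF this, of n]]
    have "((\<lambda>x. x * ?a x ^ Suc n) has_real_derivative
            real (2 * n + 3) * ?a x ^ Suc n - real (2 * n + 2) * ?a x ^ n) (at x)"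
      by (rule DERIV_cong) (simp add: field_simps power2_eq_square)
    then show "((\<lambda>x. x * ?a x ^ Suc n) has_vector_derivative
        real (2 * n + 3) * ?a x ^ Suc n - real (2 * n + 2) * ?a x ^ n) (at x within {0..sqrt 6})"
      by (simp only: has_real_derivative_iff_has_vector_derivative has_vector_derivative_at_within)
  qed simp
  moreover have "((\<lambda>x. real (2 * n + 3) * ?a x ^ Suc n - real (2 * n + 2) * ?a x ^ n) has_integral
          (real (2 * n + 3) * parabola_integral (Suc n) - real (2 * n + 2) * parabola_integral n)) {0..sqrt 6}"
    by (intro has_integral_diff has_integral_mult_right has_integral_parabola)
  ultimately have "sqrt 6 * ?a (sqrt 6) ^ Suc n - 0 * ?a 0 ^ Suc n
      = real (2 * n + 3) * parabola_integral (Suc n) - real (2 * n + 2) * parabola_integral n"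
    by (rule has_integral_unique)
  then show ?thesis by simp
qed

lemma parabola_integral_Suc:
  "parabola_integral (Suc n) = (2 * real n + 2) / (2 * real n + 3) * parabola_integral n"
  using parabola_integral_recurrence[of n] by (simp add: field_simps)

lemma parabola_integral_add_2:
  "parabola_integral (n + 2)
     = (2 * real n + 4) / (2 * real n + 5) * ((2 * real n + 2) / (2 * real n + 3) * parabola_integral n)"
proof -
  have "2 * real (Suc n) + 2 = 2 * real n + 4" "2 * real (Suc n) + 3 = 2 * real n + 5"
    by simp_all
  then show ?thesis
    using parabola_integral_Suc[of "Suc n"] parabola_integral_Suc[of n] by (simp only: add_2_eq_Suc')
qed

lemma parabola_integral_pos: "parabola_integral n > 0"
  by (induction n) (simp_all add: parabola_integral_0 parabola_integral_Suc)

text \<open>With \<open>a = 1 - x\<^sup>2 / 6\<close>, the first two binomial terms of \<open>(a + 9 / 35 (1 - a)\<^sup>2) ^ n\<close> are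
  \<open>a ^ n + 9 n / 35 (a ^ (n - 1) - 2 a ^ n + a ^ (n + 1))\<close>. The recurrence expresses the integrals of
  the two neighbouring powers by \<open>K n\<close>, and the second difference contributes
  \<open>1 / (2 n) - 1 / (2 n + 3) = 3 / (2 n (2 n + 3))\<close> times \<open>K n\<close>.\<close>

lemma integral_sinc_power_ge:
  assumes "n > 0"
  shows "parabola_integral n * (1 + 27 / (70 * (2 * real n + 3)))
           \<le> integral {0..sqrt 6} (\<lambda>x. (sin x / x) ^ n)"
proof -
  obtain m where n: "n = Suc m" using assms by (cases n) auto
  let ?a = "\<lambda>x::real. 1 - x\<^sup>2 / 6"
  let ?K = parabola_integral
  let ?g = "\<lambda>x. ?a x ^ n + 9 * real n / 35 * (?a x ^ m - 2 * ?a x ^ Suc m + ?a x ^ Suc (Suc m))"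
  have "(?g has_integral (?K n + 9 * real n / 35 * (?K m - 2 * ?K (Suc m) + ?K (Suc (Suc m))))) {0..sqrt 6}"
    by (intro has_integral_add has_integral_diff has_integral_mult_right has_integral_parabola)
  moreover have "?K n + 9 * real n / 35 * (?K m - 2 * ?K (Suc m) + ?K (Suc (Suc m)))
      = ?K n * (1 + 27 / (70 * (2 * real n + 3)))"
  proof -
    have K0: "?K m = (2 * real m + 3) / (2 * real m + 2) * ?K (Suc m)"
      using parabola_integral_recurrence[of m] by (simp add: field_simps)
    have K2: "?K (Suc (Suc m)) = (2 * real m + 4) / (2 * real m + 5) * ?K (Suc m)"
      by (simp add: parabola_integral_Suc[of "Suc m"] algebra_simps)
    have "9 * (real m + 1) / 35 * ((2 * real m + 3) / (2 * real m + 2) - 2 + (2 * real m + 4) / (2 * real m + 5))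
        = 27 / (70 * (2 * real m + 5))"
      by (simp add: divide_simps) (simp add: algebra_simps)
    moreover have "c * (a * k - 2 * k + b * k) = k * (c * (a - 2 + b))" for a b c k :: real
      by (simp add: algebra_simps)
    ultimately have *: "9 * (real m + 1) / 35 * (?K m - 2 * ?K (Suc m) + ?K (Suc (Suc m)))
        = ?K (Suc m) * (27 / (70 * (2 * real m + 5)))"
      unfolding K0 K2 by (simp only:)
    have real_n: "real n = real m + 1" and denom: "2 * real n + 3 = 2 * real m + 5"
      by (simp_all add: n)
    show ?thesis
      unfolding denom unfolding real_n * unfolding n by (simp add: distrib_left)
  qed
  ultimately have g: "(?g has_integral (?K n * (1 + 27 / (70 * (2 * real n + 3))))) {0..sqrt 6}"
    by simp
  have "?K n * (1 + 27 / (70 * (2 * real n + 3))) \<le> integral {0..sqrt 6} (\<lambda>x. sinc x ^ n)"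
  proof (rule has_integral_le[OF g integrable_integral])
    show "(\<lambda>x. sinc x ^ n) integrable_on {0..sqrt 6}"
      by (intro integrable_continuous_real continuous_intros)
    fix x :: real assume x: "x \<in> {0..sqrt 6}"
    show "?g x \<le> sinc x ^ n"
    \<comment> \<open>Here \<open>sinc 0 = 1\<close>, whereas the quotient \<open>sin x / x\<close> has the value \<open>0\<close> at \<open>0\<close>.\<close>
    proof (cases "x = 0")
      case False
      then have "x > 0" using x by auto
      have "x\<^sup>2 \<le> (sqrt 6)\<^sup>2" using x by (intro power_mono) auto
      then have "x\<^sup>2 \<le> 6" by simp
      have "?g x = ?a x ^ Suc m + real (Suc m) * ?a x ^ m * (x ^ 4 / 140)"
        unfolding n by (simp add: field_simps power2_eq_square power4_eq_xxxx)
      also have "\<dots> \<le> (?a x + x ^ 4 / 140) ^ Suc m"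
        using \<open>x\<^sup>2 \<le> 6\<close> by (intro add_power_ge) auto
      also have "\<dots> \<le> (sin x / x) ^ Suc m"
        using \<open>x > 0\<close> \<open>x\<^sup>2 \<le> 6\<close> by (intro power_mono sinc_ge_quartic add_nonneg_nonneg) auto
      finally show ?thesis using False by (simp add: n)
    qed simp
  qed
  also have "\<dots> = integral {0..sqrt 6} (\<lambda>x. (sin x / x) ^ n)"
    by (rule integral_spike[of "{0}"]) auto
  finally show ?thesis .
qed

text \<open>The interval is extended from \<open>sqrt 6\<close> to \<open>3 < \<pi>\<close>, where the integrand is still nonnegative, because
  truncation at \<open>sqrt 6\<close> would leave an error too large for \<open>n = 3\<close>.\<close>

lemma parabola_integral_le:
  assumes "n > 0"
  shows "parabola_integral n \<le> integral {0..3} (\<lambda>x. (sin x / x) ^ n)"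
proof -
  have "parabola_integral n \<le> parabola_integral n * (1 + 27 / (70 * (2 * real n + 3)))"
    using parabola_integral_pos[of n] by simp
  also have "\<dots> \<le> integral {0..sqrt 6} (\<lambda>x. (sin x / x) ^ n)"
    using assms by (rule integral_sinc_power_ge)
  also have "\<dots> \<le> integral {0..3} (\<lambda>x. (sin x / x) ^ n)"
  proof (rule integral_subset_le)
    show "{0..sqrt 6} \<subseteq> {0..3 :: real}"
      using real_le_lsqrt[of 3 6] by simp
    show "\<forall>x \<in> {0..3 :: real}. 0 \<le> (sin x / x) ^ n"
      using pi_bounds(1) by (intro ballI zero_le_power divide_nonneg_nonneg sin_ge_zero) auto
  qed (rule integrable_sinc_power)+
  finally show ?thesis .
qed

section \<open>The binomial factor\<close>

definition binomial_weight :: "nat \<Rightarrow> real" where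
  "binomial_weight n = real n * real ((n - 1) choose ((n - 1) div 2)) / 2 ^ (n - 1)"

lemma binomial_add_2:
  assumes "k \<le> n"
  shows "Suc k * Suc (n - k) * (Suc (Suc n) choose Suc k) = Suc (Suc n) * Suc n * (n choose k)"
proof -
  have "Suc k * Suc (n - k) * (Suc (Suc n) choose Suc k) = Suc (n - k) * (Suc (Suc n) * (Suc n choose k))"
    by (simp only: Suc_times_binomial[symmetric] ac_simps)
  also have "\<dots> = Suc (Suc n) * ((Suc n - k) * (Suc n choose k))"
    using assms by (simp only: Suc_diff_le ac_simps)
  also have "\<dots> = Suc (Suc n) * Suc n * (n choose k)"
    using binomial_absorb_comp[of "Suc n" k] by (simp only: diff_Suc_1 mult.assoc)
  finally show ?thesis .
qed

text \<open>The two parities of \<open>n\<close> have different binomial coefficients but the same growth factor in terms of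
  the lower index \<open>i\<close>.\<close>

lemma binomial_weight_add_2:
  assumes "n > 0"
  defines "i \<equiv> (n - 1) div 2"
  shows "binomial_weight (n + 2) = (2 * real i + 3) / (2 * real i + 2) * binomial_weight n"
proof -
  obtain j where j: "n = Suc j" using assms by (cases n) auto
  have i: "i = j div 2" unfolding i_def j by simp
  have B: "real (Suc i) * real (Suc (j - i)) * real (Suc (Suc j) choose Suc i)
      = real (Suc (Suc j)) * real (Suc j) * real (j choose i)"
    unfolding of_nat_mult[symmetric] by (subst binomial_add_2) (auto simp: i)
  have "binomial_weight (n + 2) = real (Suc (Suc (Suc j))) * real (Suc (Suc j) choose Suc i) / 2 ^ Suc (Suc j)"
    unfolding binomial_weight_def j i by (simp del: binomial_Suc_Suc)
  also have "real (Suc (Suc j) choose Suc i)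
      = real (Suc (Suc j)) * real (Suc j) * real (j choose i) / (real (Suc i) * real (Suc (j - i)))"
    using B by (simp add: field_simps del: binomial_Suc_Suc of_nat_Suc)
  also have "real (Suc (Suc (Suc j))) * \<dots> / 2 ^ Suc (Suc j)
      = real (Suc (Suc (Suc j))) * real (Suc (Suc j)) / (4 * real (Suc i) * real (Suc (j - i))) * binomial_weight n"
    unfolding binomial_weight_def j i by (simp del: of_nat_Suc add: ac_simps)
  also have "real (Suc (Suc (Suc j))) * real (Suc (Suc j)) / (4 * real (Suc i) * real (Suc (j - i)))
      = (2 * real i + 3) / (2 * real i + 2)"
  proof (cases "even j")
    case True
    then have "j = 2 * i" unfolding i by simp
    then show ?thesis
      by (intro iffD2[OF frac_eq_eq]) (simp, simp, simp add: algebra_simps)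
  next
    case False
    then have "j = 2 * i + 1" unfolding i by simp
    then show ?thesis
      by (intro iffD2[OF frac_eq_eq]) (simp, simp, simp add: algebra_simps)
  qed
  finally show ?thesis .
qed

lemma binomial_weight_pos: "n > 0 \<Longrightarrow> binomial_weight n > 0"
  unfolding binomial_weight_def by (simp add: zero_less_binomial_iff)

section \<open>Growth of the products along each parity class\<close>

lemma sqrt_6_gt: "sqrt 6 > 2449 / 1000"
  by (rule real_less_rsqrt) (simp add: power2_eq_square)

text \<open>The inequality between consecutive even exponents \<open>2 x + 6\<close> and \<open>2 x + 8\<close>: the factors for \<open>w\<close> and \<open>K\<close>
  gain more than the correction factor loses. After clearing denominators the difference of the two sides
  is a polynomial in \<open>x\<close> with nonnegative coefficients.\<close>

lemma even_product_ratio: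
  fixes x :: real
  assumes "x \<ge> 0"
  shows "1 + 27 / (70 * (4 * x + 15)) \<le>
    (2 * x + 7) / (2 * x + 6) * ((4 * x + 14) / (4 * x + 15)) * ((4 * x + 16) / (4 * x + 17))
      * (1 + 27 / (70 * (4 * x + 19)))"
proof -
  let ?N = "280 * x + 1077" and ?D = "(2 * x + 6) * ((4 * x + 17) * (4 * x + 19))"
    and ?M = "(2 * x + 7) * ((4 * x + 14) * ((4 * x + 16) * (280 * x + 1357)))"
  have pos: "2 * x + 6 > 0" "4 * x + 15 > 0" "4 * x + 17 > 0" "4 * x + 19 > 0"
    using assms by simp_all
  have "0 \<le> x\<^sup>2" by simp
  then have poly: "?N * ?D \<le> ?M"
    using assms by (simp add: algebra_simps power2_eq_square power3_eq_cube)
  have "1 + 27 / (70 * (4 * x + 15)) = ?N / (70 * (4 * x + 15))"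
    using pos by (simp add: field_simps)
  also have "\<dots> = ?N * ?D / (70 * (4 * x + 15) * ?D)"
    using pos by simp
  also have "\<dots> \<le> ?M / (70 * (4 * x + 15) * ?D)"
    using pos by (intro divide_right_mono poly) auto
  also have "\<dots> = (2 * x + 7) / (2 * x + 6) * ((4 * x + 14) / (4 * x + 15)) * ((4 * x + 16) / (4 * x + 17))
      * ((280 * x + 1357) / (70 * (4 * x + 19)))"
    by (simp only: times_divide_times_eq ac_simps)
  also have "(280 * x + 1357) / (70 * (4 * x + 19)) = 1 + 27 / (70 * (4 * x + 19))"
    using pos by (simp add: field_simps)
  finally show ?thesis .
qed

text \<open>At \<open>n = 6\<close> the product is about \<open>1.606\<close>, while \<open>\<pi> / 2\<close> is about \<open>1.571\<close>.\<close>

lemma even_product_gt: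
  "binomial_weight (2 * m + 6) * (parabola_integral (2 * m + 6) * (1 + 27 / (70 * (4 * real m + 15))))
     > 319 / 200"
proof (induction m)
  case 0
  have "5 choose 2 = (10 :: nat)"
    by (simp add: eval_nat_numeral)
  then have W: "binomial_weight (2 * 0 + 6) = 15 / 8"
    by (simp add: binomial_weight_def)
  have K: "parabola_integral (2 * 0 + 6) = 1024 / 3003 * sqrt 6"
    by (simp add: eval_nat_numeral parabola_integral_Suc parabola_integral_0)
  show ?case
    unfolding W K using sqrt_6_gt by simp
next
  case (Suc m)
  let ?W = "binomial_weight (2 * m + 6)" and ?K = "parabola_integral (2 * m + 6)"
  have "?W * ?K > 0"
    by (simp add: binomial_weight_pos parabola_integral_pos)
  have W: "binomial_weight (2 * Suc m + 6) = (2 * real m + 7) / (2 * real m + 6) * ?W"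
    using binomial_weight_add_2[of "2 * m + 6"] by (simp add: algebra_simps)
  have K: "parabola_integral (2 * Suc m + 6) = (4 * real m + 16) / (4 * real m + 17) * ((4 * real m + 14) / (4 * real m + 15) * ?K)"
    using parabola_integral_add_2[of "2 * m + 6"] by (simp add: ac_simps)
  have shift: "4 * real (Suc m) + 15 = 4 * real m + 19" by simp
  have "319 / 200 < ?W * ?K * (1 + 27 / (70 * (4 * real m + 15)))"
    using Suc by (simp only: mult.assoc)
  also have "\<dots> \<le> ?W * ?K * ((2 * real m + 7) / (2 * real m + 6) * ((4 * real m + 14) / (4 * real m + 15))
      * ((4 * real m + 16) / (4 * real m + 17)) * (1 + 27 / (70 * (4 * real m + 19))))"
    using \<open>?W * ?K > 0\<close> by (intro mult_left_mono even_product_ratio) auto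
  also have "\<dots> = binomial_weight (2 * Suc m + 6) * (parabola_integral (2 * Suc m + 6)
      * (1 + 27 / (70 * (4 * real (Suc m) + 15))))"
    unfolding W K shift by (simp only: ac_simps)
  finally show ?case .
qed

text \<open>Without the correction factor the growth factor from \<open>2 m + 3\<close> to \<open>2 m + 5\<close> is
  \<open>4 (2 m + 5)\<^sup>2 / ((4 m + 9) (4 m + 11))\<close>, whose numerator exceeds the denominator by one.\<close>

lemma odd_product_ge:
  "binomial_weight (2 * m + 3) * parabola_integral (2 * m + 3) \<ge> 24 / 35 * sqrt 6"
proof (induction m)
  case 0
  have W: "binomial_weight (2 * 0 + 3) = 3 / 2"
    by (simp add: binomial_weight_def eval_nat_numeral)
  have K: "parabola_integral (2 * 0 + 3) = 16 / 35 * sqrt 6"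
    by (simp add: eval_nat_numeral parabola_integral_Suc parabola_integral_0)
  show ?case
    unfolding W K by simp
next
  case (Suc m)
  let ?W = "binomial_weight (2 * m + 3)" and ?K = "parabola_integral (2 * m + 3)"
  have "?W * ?K > 0"
    by (simp add: binomial_weight_pos parabola_integral_pos)
  have W: "binomial_weight (2 * Suc m + 3) = (2 * real m + 5) / (2 * real m + 4) * ?W"
    using binomial_weight_add_2[of "2 * m + 3"] by (simp add: algebra_simps)
  have K: "parabola_integral (2 * Suc m + 3) = (4 * real m + 10) / (4 * real m + 11) * ((4 * real m + 8) / (4 * real m + 9) * ?K)"
    using parabola_integral_add_2[of "2 * m + 3"] by (simp add: ac_simps)
  have ratio: "1 \<le> (2 * real m + 5) / (2 * real m + 4) * ((4 * real m + 10) / (4 * real m + 11) * ((4 * real m + 8) / (4 * real m + 9)))"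
    by (simp add: divide_simps) (simp add: algebra_simps)
  have "24 / 35 * sqrt 6 \<le> ?W * ?K * 1" using Suc by simp
  also have "\<dots> \<le> ?W * ?K * ((2 * real m + 5) / (2 * real m + 4) * ((4 * real m + 10) / (4 * real m + 11) * ((4 * real m + 8) / (4 * real m + 9))))"
    using \<open>?W * ?K > 0\<close> ratio by (intro mult_left_mono) auto
  also have "\<dots> = binomial_weight (2 * Suc m + 3) * parabola_integral (2 * Suc m + 3)"
    unfolding W K by simp
  finally show ?case .
qed

text \<open>The truncation error at \<open>3\<close>, multiplied by the binomial factor; each step divides it by more than \<open>9\<close>.\<close>

lemma odd_tail_le:
  "binomial_weight (2 * m + 3) / (real (2 * m + 2) * 3 ^ (2 * m + 2)) \<le> 1 / 12"
proof (induction m)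
  case 0
  show ?case by (simp add: binomial_weight_def eval_nat_numeral)
next
  case (Suc m)
  let ?W = "binomial_weight (2 * m + 3)"
  have "?W > 0" by (simp add: binomial_weight_pos)
  have W: "binomial_weight (2 * Suc m + 3) = (2 * real m + 5) / (2 * real m + 4) * ?W"
    using binomial_weight_add_2[of "2 * m + 3"] by (simp add: algebra_simps)
  have ratio: "(2 * x + 5) / (2 * x + 4) * w / ((2 * x + 4) * (9 * p))
      = w / ((2 * x + 2) * p) * ((2 * x + 5) / (2 * x + 4) * ((2 * x + 2) / (2 * x + 4)) / 9)"
    if "x \<ge> 0" "p > 0" for x p w :: real
    using that by (simp add: divide_simps)
  have "binomial_weight (2 * Suc m + 3) / (real (2 * Suc m + 2) * 3 ^ (2 * Suc m + 2))
      = ?W / (real (2 * m + 2) * 3 ^ (2 * m + 2)) *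
        ((2 * real m + 5) / (2 * real m + 4) * ((2 * real m + 2) / (2 * real m + 4)) / 9)"
    unfolding W using ratio[of "real m" "3 ^ (2 * m + 2)" ?W] by (simp add: algebra_simps)
  also have "\<dots> \<le> ?W / (real (2 * m + 2) * 3 ^ (2 * m + 2)) * 1"
    using \<open>?W > 0\<close>
    by (intro mult_left_mono) (simp_all add: divide_simps, simp add: algebra_simps)
  also have "\<dots> \<le> 1 / 12" using Suc by (simp only: mult_1_right)
  finally show ?case .
qed

lemma weighted_sinc_power_integral_gt:
  assumes "n > 2" "n \<noteq> 4"
  shows "binomial_weight n * sinc_power_integral n > 319 / 200"
proof (cases "even n")
  case True
  then have "n \<ge> 6" "even (n - 6)" using assms by presburger+
  then obtain m where m: "n = 2 * m + 6"
    by (metis add.commute evenE le_add_diff_inverse)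
  have "parabola_integral n * (1 + 27 / (70 * (2 * real n + 3))) \<le> sinc_power_integral n"
    using integral_sinc_power_ge[of n] sinc_power_integral_even_ge[OF True, of "sqrt 6"] assms by linarith
  then have "binomial_weight n * (parabola_integral n * (1 + 27 / (70 * (2 * real n + 3))))
      \<le> binomial_weight n * sinc_power_integral n"
    using binomial_weight_pos[of n] assms by (intro mult_left_mono) auto
  moreover have "2 * real n + 3 = 4 * real m + 15" by (simp add: m)
  ultimately show ?thesis
    using even_product_gt[of m] unfolding m by (simp only:)
next
  case False
  then have "n \<ge> 3" "even (n - 3)" using assms by presburger+
  then obtain m where m: "n = 2 * m + 3"
    by (metis add.commute evenE le_add_diff_inverse)
  then have Suc: "n = Suc (2 * m + 2)" by simp
  have "parabola_integral n - 1 / (real (2 * m + 2) * 3 ^ (2 * m + 2)) \<le> sinc_power_integral n"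
    using parabola_integral_le[of n] sinc_power_integral_tendsto(2)[of "2 * m + 2" 3, folded Suc] assms
    by linarith
  then have "binomial_weight n * (parabola_integral n - 1 / (real (2 * m + 2) * 3 ^ (2 * m + 2)))
      \<le> binomial_weight n * sinc_power_integral n"
    using binomial_weight_pos[of n] assms by (intro mult_left_mono) auto
  moreover have "binomial_weight n * (parabola_integral n - 1 / (real (2 * m + 2) * 3 ^ (2 * m + 2)))
      = binomial_weight n * parabola_integral n - binomial_weight n / (real (2 * m + 2) * 3 ^ (2 * m + 2))"
    by (simp add: algebra_simps)
  moreover note odd_product_ge[of m, folded m] odd_tail_le[of m, folded m] sqrt_6_gt
  ultimately show ?thesis by linarith
qed

theorem proposition1p3:
  fixes n :: nat
  assumes "n > 0" and "n \<noteq> 4"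
    and "n \<noteq> 1" and "n \<noteq> 2"
  shows "2 powi (1 - int n) * real n * real ((n - 1) choose ((n - 1) div 2))
       > inverse (2 / pi * sinc_power_integral n)"
proof -
  let ?I = "sinc_power_integral n"
  have "n > 2" using assms by linarith
  have exponent: "1 - int n = - int (n - 1)" using assms by simp
  have weight: "2 powi (1 - int n) * real n * real ((n - 1) choose ((n - 1) div 2)) = binomial_weight n"
    unfolding binomial_weight_def exponent
    by (simp only: power_int_minus power_int_of_nat divide_inverse ac_simps)
  have gt: "pi / 2 < binomial_weight n * ?I"
    using weighted_sinc_power_integral_gt[OF \<open>n > 2\<close> assms(2)] pi_bounds(2) by linarith
  then have "0 < binomial_weight n * ?I" using pi_gt_zero by linarith
  then have "?I > 0"
    using binomial_weight_pos[OF assms(1)] by (simp add: zero_less_mult_iff)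
  then show ?thesis
    unfolding weight using gt by (simp add: field_simps)
qed

end
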